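(* Let $\bm{n}\in\mathbb{N}^r$ and suppose that $\bm{\mu}=(\mu_1,\dots,\mu_r)$ is an AT system on the arc $\Gamma=\{e^{i\theta}:\alpha\le\theta\le\beta\}$ for the multi-index $\bm{n}$, and let the branch of the square root be the one with $t_0=\alpha$. Then $\bm{n}$ is normal (i.e. $\phi$-normal) with respect to $\bm{\mu}$.
   Context: $\mathbb{N}=\{0,1,2,\dots\}$; $\partial\mathbb{D}=\{z\in\mathbb{C}:|z|=1\}$; for $\bm{n}=(n_1,\dots,n_r)\in\mathbb{N}^r$, $|\bm{n}|=n_1+\dots+n_r$. Chebyshev system: a collection $u_1,\dots,u_n$ of continuous real-valued functions on $[a,b]$ is Chebyshev on $[a,b]$ if $\det(u_j(x_k))_{1\le j,k\le n}\ne0$ for every choice of distinct points $x_1,\dots,x_n\in[a,b]$. For a function $f(\theta)$ and $m\in\mathbb{N}$: if $m$ is even, $\operatorname{Trig}_m(f)=\{f(\theta)\cos\frac{2k-1}{2}\theta,\ f(\theta)\sin\frac{2k-1}{2}\theta\}_{k=1}^{m/2}$ (empty for $m=0$); if $m$ is odd, $\operatorname{Trig}_m(f)=\{f(\theta)\}\cup\{f(\theta)\cos k\theta,\ f(\theta)\sin k\theta\}_{k=1}^{(m-1)/2}$. AT system: let $0<\beta-\alpha\le2\pi$, let $\mu$ be a probability measure with infinite support on the arc $\Gamma=\{e^{i\theta}:\alpha\le\theta\le\beta\}\subset\partial\mathbb{D}$, and for each $j=1,\dots,r$ let $d\mu_j(e^{i\theta})=w_j(\theta)\,d\mu(e^{i\theta})$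 be a measure absolutely continuous with respect to $\mu$ (if $\beta-\alpha=2\pi$, points of $\Gamma$ are parametrized by $\theta\in[\alpha,\alpha+2\pi)$). Then $\bm{\mu}$ is an AT system on $\Gamma$ for $\bm{n}$ if the collection of $|\bm{n}|$ functions $\bigcup_{j=1}^r\operatorname{Trig}_{n_j}(w_j)$ (listed with repetition) is Chebyshev on $[\alpha,\beta]$. Branch: $z^{1/2}=|z|^{1/2}\exp(\tfrac{i}{2}\arg z)$ with $\arg z\in[t_0,t_0+2\pi)$; for $m\in\mathbb{Z}$, $z^{m/2}:=(z^{1/2})^m$. Normality: $\bm{n}$ is $\phi$-normal (or simply normal) with respect to $\bm{\mu}$ if there exists a unique function of the form $$\phi_{\bm{n}}(z)=z^{|\bm{n}|/2}+\kappa_{|\bm{n}|/2-1}z^{|\bm{n}|/2-1}+\dots+\kappa_{-|\bm{n}|/2}z^{-|\bm{n}|/2}$$ (complex coefficients, exponents decreasing in steps of $1$) satisfying, for every $j=1,\dots,r$, $$\int\phi_{\bm{n}}(z)z^{-k}\,d\mu_j(z)=0,\qquad k=-\tfrac{n_j}{2},-\tfrac{n_j}{2}+1,\dots,\tfrac{n_j}{2}-1$$ (no condition for $j$ if $n_j=0$). The index $\bm{0}$ is normal, with $\phi_{\bm{0}}=1$. *)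

theory Defs
  imports "HOL-Analysis.Analysis" "HOL-Probability.Probability" "Jordan_Normal_Form.Determinant"
begin

text \<open>
  Multi-indices \<open>(n\<^sub>1, \<dots>, n\<^sub>r)\<close> and systems of measures \<open>(\<mu>\<^sub>1, \<dots>, \<mu>\<^sub>r)\<close> are functions on \<open>nat\<close> of which
  only the values at \<open>{1..r}\<close> matter. Measures on the unit circle are Borel measures on the complex
  plane.
\<close>

definition mi_size :: "nat \<Rightarrow> (nat \<Rightarrow> nat) \<Rightarrow> nat" where
  "mi_size r n = (\<Sum>j = 1..r. n j)"

text \<open>
  The collection of functions is a list, so that repetitions count.
\<close>

definition chebyshev_on :: "real \<Rightarrow> real \<Rightarrow> (real \<Rightarrow> real) list \<Rightarrow> bool" where
  "chebyshev_on a b us \<longleftrightarrow>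
     (\<forall>u\<in>set us. continuous_on {a..b} u) \<and>
     (\<forall>x :: nat \<Rightarrow> real. inj_on x {..<length us} \<and> x ` {..<length us} \<subseteq> {a..b} \<longrightarrow>
        Determinant.det (Matrix.mat (length us) (length us) (\<lambda>(j, k). (us ! j) (x k))) \<noteq> 0)"

definition Trig :: "nat \<Rightarrow> (real \<Rightarrow> real) \<Rightarrow> (real \<Rightarrow> real) list" where
  "Trig m f =
     (if even m
      then concat (map (\<lambda>k. [\<lambda>\<theta>. f \<theta> * cos ((2 * real k - 1) / 2 * \<theta>),
                             \<lambda>\<theta>. f \<theta> * sin ((2 * real k - 1) / 2 * \<theta>)]) [1..<Suc (m div 2)])
      else f # concat (map (\<lambda>k. [\<lambda>\<theta>. f \<theta> * cos (real k * \<theta>),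
                                 \<lambda>\<theta>. f \<theta> * sin (real k * \<theta>)]) [1..<Suc ((m - 1) div 2)]))"

definition circle_arc :: "real \<Rightarrow> real \<Rightarrow> complex set" where
  "circle_arc \<alpha> \<beta> = cis ` {\<alpha>..\<beta>}"

definition arg_from :: "real \<Rightarrow> complex \<Rightarrow> real" where
  "arg_from t0 z = (THE t. t0 \<le> t \<and> t < t0 + 2 * pi \<and> is_Arg z t)"

lemma arg_from_eqI:
  assumes "z \<noteq> 0" "t0 \<le> t" "t < t0 + 2 * pi" "is_Arg z t"
  shows "arg_from t0 z = t"
  unfolding arg_from_def
proof (rule the_equality)
  fix s assume s: "t0 \<le> s \<and> s < t0 + 2 * pi \<and> is_Arg z s"
  have "exp (\<i> * complex_of_real s) = exp (\<i> * complex_of_real t)"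
    using s assms(1,4) unfolding is_Arg_def by (metis mult_cancel_left norm_eq_zero of_real_eq_0_iff)
  then obtain k :: int where
    "\<i> * complex_of_real s = \<i> * complex_of_real t + of_real (of_int (2 * k) * pi) * \<i>"
    unfolding exp_eq by blast
  from arg_cong[OF this, of Im] have k: "s = t + 2 * pi * k"
    by simp
  have "\<bar>2 * pi * k\<bar> < 2 * pi * 1"
    using s assms(2,3) k by linarith
  then have "\<bar>real_of_int k\<bar> < 1"
    by (simp add: abs_mult)
  then have "k = 0"
    by linarith
  with k show "s = t"
    by simp
qed (use assms in auto)

lemma arg_from_eq_Arg2pi:
  assumes "z \<noteq> 0"
  shows "arg_from t0 z = t0 + Arg2pi (z * cis (- t0))"
proof (rule arg_from_eqI[OF assms])
  let ?s = "Arg2pi (z * cis (- t0))"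
  show "t0 \<le> t0 + ?s" "t0 + ?s < t0 + 2 * pi"
    using Arg2pi_ge_0 Arg2pi_lt_2pi by auto
  have "z * cis (- t0) = of_real (norm z) * cis ?s"
    using Arg2pi_eq[of "z * cis (- t0)"] by (simp add: norm_mult cis_conv_exp)
  then have "z * cis (- t0) * cis t0 = of_real (norm z) * (cis ?s * cis t0)"
    by simp
  then show "is_Arg z (t0 + ?s)"
    unfolding is_Arg_def cis_conv_exp[symmetric]
    by (simp add: cis_mult mult.assoc add.commute)
qed

text \<open>
  \<open>half_pow t0 m z\<close> is the power of \<open>z\<close> with exponent \<open>m/2\<close>.
\<close>

definition sqrt_branch :: "real \<Rightarrow> complex \<Rightarrow> complex" where
  "sqrt_branch t0 z = of_real (sqrt (norm z)) * exp (\<i> / 2 * of_real (arg_from t0 z))"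

definition half_pow :: "real \<Rightarrow> int \<Rightarrow> complex \<Rightarrow> complex" where
  "half_pow t0 m z = sqrt_branch t0 z powi m"

definition measure_support :: "'a::topological_space measure \<Rightarrow> 'a set" where
  "measure_support M = {x. \<forall>U. open U \<and> x \<in> U \<longrightarrow> emeasure M U > 0}"

text \<open>
  The densities are functions of the angle; a point of the arc has the angle in
  \<open>[\<alpha>, \<alpha> + 2\<pi>)\<close>, which lies in \<open>[\<alpha>, \<beta>]\<close>. The condition of nonnegativity almost everywhere expresses
  that \<open>M j\<close> is a (positive) measure.
\<close>

definition AT_system :: "real \<Rightarrow> real \<Rightarrow> nat \<Rightarrow> (nat \<Rightarrow> nat) \<Rightarrow> (nat \<Rightarrow> complex measure) \<Rightarrow> bool" where
  "AT_system \<alpha> \<beta> r n M \<longleftrightarrow>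
     0 < \<beta> - \<alpha> \<and> \<beta> - \<alpha> \<le> 2 * pi \<and>
     (\<exists>(\<mu> :: complex measure) (w :: nat \<Rightarrow> real \<Rightarrow> real).
        sets \<mu> = sets borel \<and> prob_space \<mu> \<and>
        (AE z in \<mu>. z \<in> circle_arc \<alpha> \<beta>) \<and> infinite (measure_support \<mu>) \<and>
        (\<forall>j\<in>{1..r}.
           (\<lambda>z. w j (arg_from \<alpha> z)) \<in> borel_measurable \<mu> \<and>
           (AE z in \<mu>. 0 \<le> w j (arg_from \<alpha> z)) \<and>
           M j = density \<mu> (\<lambda>z. ennreal (w j (arg_from \<alpha> z)))) \<and>
        chebyshev_on \<alpha> \<beta> (concat (map (\<lambda>j. Trig (n j) (w j)) [1..<Suc r])))"

text \<open>
  The Laurent polynomial in the square root has the exponents \<open>|n|/2 - l\<close> for \<open>l = 0, \<dots>, |n|\<close>, and the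
  orthogonality conditions have \<open>k = -n\<^sub>j/2 + i\<close> for \<open>i = 0, \<dots>, n\<^sub>j - 1\<close>, so that \<open>-k = (n\<^sub>j - 2i)/2\<close>.
\<close>

definition phi_form :: "real \<Rightarrow> nat \<Rightarrow> (complex \<Rightarrow> complex) \<Rightarrow> bool" where
  "phi_form t0 N \<phi> \<longleftrightarrow>
     (\<exists>\<kappa> :: nat \<Rightarrow> complex. \<phi> = (\<lambda>z. half_pow t0 (int N) z +
        (\<Sum>l = 1..N. \<kappa> l * half_pow t0 (int N - 2 * int l) z)))"

definition phi_orthogonal ::
    "real \<Rightarrow> nat \<Rightarrow> (nat \<Rightarrow> nat) \<Rightarrow> (nat \<Rightarrow> complex measure) \<Rightarrow> (complex \<Rightarrow> complex) \<Rightarrow> bool" where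
  "phi_orthogonal t0 r n M \<phi> \<longleftrightarrow>
     (\<forall>j\<in>{1..r}. \<forall>i<n j.
        has_bochner_integral (M j) (\<lambda>z. \<phi> z * half_pow t0 (int (n j) - 2 * int i) z) 0)"

definition phi_normal :: "real \<Rightarrow> nat \<Rightarrow> (nat \<Rightarrow> nat) \<Rightarrow> (nat \<Rightarrow> complex measure) \<Rightarrow> bool" where
  "phi_normal t0 r n M \<longleftrightarrow>
     (\<exists>!\<phi>. phi_form t0 (mi_size r n) \<phi> \<and> phi_orthogonal t0 r n M \<phi>)"

end

theory Submission
  imports Defs
begin

text \<open>
  Multiplying by \<open>z\<^sup>1\<^sup>/\<^sup>2\<close> turns the orthogonality conditions into the vanishing of the integrals of
  \<open>z\<^sup>1\<^sup>/\<^sup>2 \<phi>\<close> against the \<open>N = |n|\<close> real functions \<open>u\<^sub>m\<close> of the AT system. This is a square linear system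
  for the coefficients of \<open>\<phi>\<close> with matrix \<open>A\<^sub>l\<^sub>m = \<integral> e\<^sub>l u\<^sub>m d\<mu>\<close>, where \<open>e\<^sub>l = exp(i((N-1)/2 - l)\<theta>)\<close>. By
  Andreief's identity, \<open>N! det A\<close> is the integral of \<open>det(e\<^sub>l(x\<^sub>k)) det(u\<^sub>m(x\<^sub>k))\<close> with respect to the
  \<open>N\<close>-fold product of \<open>\<mu>\<close>. Up to a constant factor the integrand is real, it is symmetric in the
  points, and it vanishes only where two points coincide. The ordered tuples form a convex set, so the
  integrand has constant sign, and since the support of \<open>\<mu>\<close> is infinite the integral is not zero.
\<close>

section \<open>Collocation determinants and Andreief's identity\<close>

definition collocation_mat :: "nat \<Rightarrow> (nat \<Rightarrow> 'a \<Rightarrow> 'b) \<Rightarrow> (nat \<Rightarrow> 'a) \<Rightarrow> 'b mat" where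
  "collocation_mat N u x = Matrix.mat N N (\<lambda>(j, k). u j (x k))"

lemma collocation_mat_carrier [simp]: "collocation_mat N u x \<in> carrier_mat N N"
  by (simp add: collocation_mat_def)

lemma det_collocation_mat:
  fixes u :: "nat \<Rightarrow> 'a \<Rightarrow> 'b::comm_ring_1"
  shows "det (collocation_mat N u x) =
    (\<Sum>p | p permutes {0..<N}. of_int (sign p) * (\<Prod>k = 0..<N. u (p k) (x k)))"
proof -
  have "(\<Prod>k = 0..<N. collocation_mat N u x $$ (p k, k)) = (\<Prod>k = 0..<N. u (p k) (x k))"
    if "p permutes {0..<N}" for p
    using that permutes_in_image[OF that] by (intro prod.cong) (auto simp: collocation_mat_def)
  moreover have "dim_row (collocation_mat N u x) = N"
    by (simp add: collocation_mat_def)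
  ultimately show ?thesis
    by (simp add: mat_det_left_def[OF collocation_mat_carrier])
qed

text \<open>Permuting the points permutes the columns; the transpose is taken because
  \<open>det_permute_rows\<close> acts on rows.\<close>

lemma det_collocation_mat_permute:
  fixes u :: "nat \<Rightarrow> 'a \<Rightarrow> 'b::comm_ring_1"
  assumes p: "p permutes {0..<N}"
  shows "det (collocation_mat N u (\<lambda>k. x (p k))) =
    of_int (sign p) * det (collocation_mat N u x)"
proof -
  let ?A = "transpose_mat (collocation_mat N u x)"
  have "Matrix.mat N N (\<lambda>(i, j). ?A $$ (p i, j)) = transpose_mat (collocation_mat N u (\<lambda>k. x (p k)))"
    using permutes_in_image[OF p] by (intro eq_matI) (auto simp: collocation_mat_def)
  then show ?thesis
    using det_permute_rows[of ?A N p] p by (simp add: det_transpose[of _ N])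
qed

text \<open>Andreief's identity. Expanding both determinants gives a double sum over permutations
  \<open>p\<close> and \<open>q\<close>; the product measure factors the integral of each summand
  into one-dimensional integrals, which are entries of the moment matrix.\<close>

lemma
  fixes f g :: "nat \<Rightarrow> 'a \<Rightarrow> 'b::{real_normed_field,banach,second_countable_topology}"
  assumes "sigma_finite_measure \<mu>"
    and int: "\<And>l m. l < N \<Longrightarrow> m < N \<Longrightarrow> integrable \<mu> (\<lambda>z. f l z * g m z)"
  shows integrable_det_mult_det: "integrable (PiM {0..<N} (\<lambda>_. \<mu>))
      (\<lambda>x. det (collocation_mat N f x) * det (collocation_mat N g x))"
    and integral_det_mult_det: "(\<integral>x. det (collocation_mat N f x) *
        det (collocation_mat N g x) \<partial>PiM {0..<N} (\<lambda>_. \<mu>)) =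
      fact N * det (Matrix.mat N N (\<lambda>(l, m). \<integral>z. f l z * g m z \<partial>\<mu>))"
proof -
  interpret product_sigma_finite "\<lambda>_::nat. \<mu>"
    using assms(1) by (simp add: product_sigma_finite_def)
  let ?P = "{p. p permutes {0..<N}}"
  define A where "A = Matrix.mat N N (\<lambda>(l, m). \<integral>z. f l z * g m z \<partial>\<mu>)"
  have A: "A \<in> carrier_mat N N"
    by (simp add: A_def)
  have expand: "det (collocation_mat N f x) * det (collocation_mat N g x) =
      (\<Sum>p\<in>?P. \<Sum>q\<in>?P. of_int (sign p * sign q) * (\<Prod>k = 0..<N. f (p k) (x k) * g (q k) (x k)))"
    for x :: "nat \<Rightarrow> 'a"
    by (simp add: det_collocation_mat sum_product prod.distrib algebra_simps)
  have lt: "p k < N" if "p \<in> ?P" "k < N" for p k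
    using that permutes_in_image[of p "{0..<N}" k] by auto
  have int': "integrable (PiM {0..<N} (\<lambda>_. \<mu>)) (\<lambda>x. \<Prod>k = 0..<N. f (p k) (x k) * g (q k) (x k))"
    if "p \<in> ?P" "q \<in> ?P" for p q
    using that by (intro product_integrable_prod int) (auto intro: lt)
  show "integrable (PiM {0..<N} (\<lambda>_. \<mu>))
      (\<lambda>x. det (collocation_mat N f x) * det (collocation_mat N g x))"
    unfolding expand by (intro Bochner_Integration.integrable_sum integrable_mult_right int')
  have "(\<integral>x. det (collocation_mat N f x) *
        det (collocation_mat N g x) \<partial>PiM {0..<N} (\<lambda>_. \<mu>)) =
      (\<Sum>p\<in>?P. \<Sum>q\<in>?P. of_int (sign p * sign q) *
        (\<integral>x. (\<Prod>k = 0..<N. f (p k) (x k) * g (q k) (x k)) \<partial>PiM {0..<N} (\<lambda>_. \<mu>)))"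
    unfolding expand
    apply (subst Bochner_Integration.integral_sum)
     apply (intro Bochner_Integration.integrable_sum integrable_mult_right int'; assumption)
    apply (intro sum.cong refl)
    apply (subst Bochner_Integration.integral_sum)
     apply (intro integrable_mult_right int'; assumption)
    apply (rule sum.cong[OF refl], rule integral_mult_right_zero)
    done
  also have "\<dots> = (\<Sum>p\<in>?P. \<Sum>q\<in>?P. of_int (sign p * sign q) * (\<Prod>k = 0..<N. A $$ (p k, q k)))"
  proof (intro sum.cong refl arg_cong2[where f = "(*)"])
    fix p q assume pq: "p \<in> ?P" "q \<in> ?P"
    show "(\<integral>x. (\<Prod>k = 0..<N. f (p k) (x k) * g (q k) (x k)) \<partial>PiM {0..<N} (\<lambda>_. \<mu>)) =
        (\<Prod>k = 0..<N. A $$ (p k, q k))"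
      using pq by (subst product_integral_prod) (auto intro!: int prod.cong simp: A_def lt)
  qed
  \<comment> \<open>For fixed \<open>p\<close> the sum over \<open>q\<close> is the Leibniz formula
    for \<open>A\<close> with rows permuted by \<open>p\<close>. That determinant is
    \<open>sign p * det A\<close>, so the two signs cancel and each of the N! permutations
    contributes \<open>det A\<close>.\<close>
  also have "\<dots> = (\<Sum>p\<in>?P. of_int (sign p) *
      det (Matrix.mat N N (\<lambda>(i, j). A $$ (p i, j))))"
  proof (intro sum.cong refl)
    fix p assume p: "p \<in> ?P"
    have "det (Matrix.mat N N (\<lambda>(i, j). A $$ (p i, j))) =
        (\<Sum>q\<in>?P. of_int (sign q) * (\<Prod>k = 0..<N. A $$ (p k, q k)))"
      by (subst det_def'[of _ N]) (auto intro!: sum.cong prod.cong simp: lt)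
    then show "(\<Sum>q\<in>?P. of_int (sign p * sign q) * (\<Prod>k = 0..<N. A $$ (p k, q k))) =
        of_int (sign p) * det (Matrix.mat N N (\<lambda>(i, j). A $$ (p i, j)))"
      by (simp add: sum_distrib_left mult.assoc)
  qed
  also have "\<dots> = (\<Sum>p\<in>?P. det A)"
    by (intro sum.cong refl)
      (simp add: det_permute_rows[OF A] mult.assoc[symmetric] of_int_mult[symmetric] del: of_int_mult)
  also have "\<dots> = fact N * det A"
    using card_permutations[of "{0..<N}" N] by simp
  finally show "(\<integral>x. det (collocation_mat N f x) *
        det (collocation_mat N g x) \<partial>PiM {0..<N} (\<lambda>_. \<mu>)) =
      fact N * det (Matrix.mat N N (\<lambda>(l, m). \<integral>z. f l z * g m z \<partial>\<mu>))"
    by (simp add: A_def)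
qed

section \<open>The system of exponentials\<close>

text \<open>The exponents run from (N-1)/2 down to -(N-1)/2, symmetrically about 0. They are those
  of z^(N/2 - 1), ..., z^(-N/2) after multiplication by z^(1/2); for N = n_j they are also those of
  the test functions z^(n_j/2 - i) after division by z^(1/2).\<close>

definition half_exp :: "nat \<Rightarrow> nat \<Rightarrow> real \<Rightarrow> complex" where
  "half_exp N l \<theta> = cis (((real N - 1) / 2 - real l) * \<theta>)"

lemma cis_inj_on_period: "inj_on cis {a..<a + 2 * pi}"
proof (rule inj_onI)
  fix x y assume xy: "x \<in> {a..<a + 2 * pi}" "y \<in> {a..<a + 2 * pi}" "cis x = cis y"
  have "arg_from a (cis x) = x" "arg_from a (cis y) = y"
    using xy(1,2) by (auto intro!: arg_from_eqI simp: is_Arg_def cis_conv_exp)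
  with xy(3) show "x = y"
    by metis
qed

text \<open>Without the factor exp(i(N-1)x_k/2) of each column this is a Vandermonde determinant
  with nodes exp(-i x_k), distinct because the x_k lie in one half-open period. A linear relation
  between the rows would be a nonzero polynomial of degree below N with N roots.\<close>

lemma det_half_exp_nonzero:
  assumes inj: "inj_on x {0..<N}" and x: "x ` {0..<N} \<subseteq> {a..<a + 2 * pi}"
  shows "det (collocation_mat N (half_exp N) x) \<noteq> 0"
proof
  let ?A = "transpose_mat (collocation_mat N (half_exp N) x)"
  assume "det (collocation_mat N (half_exp N) x) = 0"
  then have "det ?A = 0"
    by (simp add: det_transpose[of _ N])
  then obtain v where v: "v \<in> carrier_vec N" "v \<noteq> 0\<^sub>v N" "?A *\<^sub>v v = 0\<^sub>v N"
    using det_0_iff_vec_prod_zero_field[of ?A N] by auto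
  define p where "p = (\<Sum>l<N. monom (v $ l) l)"
  have coeff: "coeff p l = (if l < N then v $ l else 0)" for l
    by (auto simp: p_def coeff_sum)
  have "p \<noteq> 0"
  proof
    assume "p = 0"
    then have "v $ l = 0" if "l < N" for l
      using coeff[of l] that by simp
    with v(1,2) show False
      by (auto intro: eq_vecI)
  qed
  \<comment> \<open>The degree bound at the end is N - 1 with natural subtraction, which is below N
    only for positive N.\<close>
  then have "N > 0"
    by (cases N) (auto simp: p_def)
  have root: "poly p (cis (- x k)) = 0" if "k < N" for k
  proof -
    have "(\<Sum>l<N. half_exp N l (x k) * v $ l) = (?A *\<^sub>v v) $ k"
      using that v(1) by (auto simp: scalar_prod_def collocation_mat_def atLeast0LessThan intro!: sum.cong)
    then have 0: "(\<Sum>l<N. half_exp N l (x k) * v $ l) = 0"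
      using that v(3) by simp
    have "half_exp N l (x k) = cis ((real N - 1) / 2 * x k) * cis (- x k) ^ l" for l
      unfolding half_exp_def Complex.DeMoivre cis_mult by (rule arg_cong[of _ _ cis]) (simp add: algebra_simps)
    with 0 have "cis ((real N - 1) / 2 * x k) * (\<Sum>l<N. v $ l * cis (- x k) ^ l) = 0"
      by (simp add: sum_distrib_left mult_ac)
    then show ?thesis
      by (simp add: p_def poly_sum poly_monom)
  qed
  have "inj_on (\<lambda>k. cis (- x k)) {0..<N}"
  proof (rule inj_onI)
    fix i j assume ij: "i \<in> {0..<N}" "j \<in> {0..<N}" "cis (- x i) = cis (- x j)"
    then have "cis (x i) = cis (x j)"
      by (metis cis_cnj complex_cnj_cnj)
    then have "x i = x j"
      by (rule inj_onD[OF cis_inj_on_period[of a]]) (use ij(1,2) x in blast)+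
    with inj ij(1,2) show "i = j"
      by (auto dest: inj_onD)
  qed
  then have "N = card ((\<lambda>k. cis (- x k)) ` {0..<N})"
    by (simp add: card_image)
  also have "\<dots> \<le> card {z. poly p z = 0}"
    using root \<open>p \<noteq> 0\<close> by (intro card_mono poly_roots_finite) auto
  also have "\<dots> \<le> degree p"
    using \<open>p \<noteq> 0\<close> by (rule card_poly_roots_bound)
  also have "\<dots> < N"
    using \<open>N > 0\<close> by (intro le_less_trans[OF degree_le[of "N - 1"]]) (auto simp: coeff)
  finally show False
    by simp
qed

text \<open>Complex conjugation reverses the order of the rows.\<close>

lemma det_half_exp_real_multiple:
  obtains c :: complex where "c \<noteq> 0"
    "\<And>x. c * det (collocation_mat N (half_exp N) x) \<in> \<real>"
proof -
  \<comment> \<open>\<open>r\<close> reverses the row indices, which negates the exponents, and is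
    the identity elsewhere, as \<open>permutes\<close> demands.\<close>
  define r where "r l = (if l < N then N - 1 - l else l)" for l
  have r: "r permutes {0..<N}"
    by (intro bij_imp_permutes bij_betw_byWitness[where f' = r]) (auto simp: r_def)
  have *: "cnj (det (collocation_mat N (half_exp N) x)) =
      of_int (sign r) * det (collocation_mat N (half_exp N) x)" for x
  proof -
    interpret cnj: comm_ring_hom cnj
      by unfold_locales auto
    let ?A = "collocation_mat N (half_exp N) x"
    have "map_mat cnj ?A = Matrix.mat N N (\<lambda>(i, j). ?A $$ (r i, j))"
      by (intro eq_matI)
        (auto simp: collocation_mat_def r_def half_exp_def cis_cnj of_nat_diff field_simps
          intro!: arg_cong[of _ _ cis])
    then show ?thesis
      using det_permute_rows[OF _ r, of ?A] by (simp flip: cnj.hom_det)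
  qed
  \<comment> \<open>An even reversal makes the determinant real, an odd one purely imaginary; in the
    second case the factor i makes it real.\<close>
  show thesis
  proof (cases "sign r = 1")
    case True
    then show ?thesis
      using * by (intro that[of 1]) (auto simp: Reals_cnj_iff)
  next
    case False
    then have "sign r = -1"
      by (auto simp: sign_def)
    then show ?thesis
      using * by (intro that[of \<i>]) (auto simp: Reals_cnj_iff)
  qed
qed

section \<open>Constant sign on ordered tuples\<close>

text \<open>Reduces tuples with distinct entries to increasing ones: the latter form a convex set,
  the former in general do not. The permutation is the one that sorts the list of values.\<close>

lemma ex_permutes_strict_mono:
  fixes x :: "nat \<Rightarrow> 'a::linorder"
  assumes "inj_on x {0..<N}"
  obtains p where "p permutes {0..<N}" "strict_mono_on {0..<N} (\<lambda>k. x (p k))"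
proof -
  let ?xs = "map x [0..<N]"
  obtain p where p: "p permutes {..<length ?xs}" "permute_list p ?xs = sort ?xs"
    using mset_eq_permutation[of "sort ?xs" ?xs] by auto
  have p': "p permutes {0..<N}"
    using p(1) by (simp add: atLeast0LessThan)
  have nth: "sort ?xs ! k = x (p k)" if "k < N" for k
    using that permutes_in_image[OF p', of k] p(1) by (simp flip: p(2) add: permute_list_nth)
  have "sorted_wrt (<) (sort ?xs)"
    using assms by (simp add: strict_sorted_iff distinct_map)
  then have "x (p i) < x (p j)" if "i < j" "j < N" for i j
    using sorted_wrt_nth_less[of "(<)" "sort ?xs" i j] that nth[of i] nth[of j] by simp
  then show thesis
    using p' by (intro that[of p]) (auto simp: strict_mono_on_def)
qed

text \<open>A convex combination of two increasing tuples in \<open>I\<close> is again one, so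
  \<open>F\<close> has no zero on the segment from \<open>x\<close> to \<open>y\<close>, and the
  intermediate value theorem excludes a change of sign. Continuity is asked along this segment only,
  so that no topology on tuples enters.\<close>

lemma sign_constant_on_increasing_tuples:
  fixes F :: "(nat \<Rightarrow> real) \<Rightarrow> real" and x y :: "nat \<Rightarrow> real"
  assumes I: "convex I"
    and cont: "continuous_on {0..1} (\<lambda>s. F (\<lambda>k. (1 - s) * x k + s * y k))"
    and nz: "\<And>z. strict_mono_on {0..<N} z \<Longrightarrow> z ` {0..<N} \<subseteq> I \<Longrightarrow> F z \<noteq> 0"
    and x: "strict_mono_on {0..<N} x" "x ` {0..<N} \<subseteq> I"
    and y: "strict_mono_on {0..<N} y" "y ` {0..<N} \<subseteq> I"
  shows "F x * F y > 0"
proof (rule ccontr)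
  define g where "g s = F (\<lambda>k. (1 - s) * x k + s * y k)" for s
  have g_nz: "g s \<noteq> 0" if s: "0 \<le> s" "s \<le> 1" for s
    unfolding g_def
  proof (rule nz)
    show "strict_mono_on {0..<N} (\<lambda>k. (1 - s) * x k + s * y k)"
    proof (rule strict_mono_onI)
      fix i j assume ij: "i \<in> {0..<N}" "j \<in> {0..<N}" "i < j"
      then have lt: "x i < x j" "y i < y j"
        using x(1) y(1) by (auto simp: strict_mono_on_def)
      \<comment> \<open>For s > 0 the strictness comes from the summand with \<open>y\<close>; at s
        = 0 only \<open>x\<close> remains.\<close>
      show "(1 - s) * x i + s * y i < (1 - s) * x j + s * y j"
      proof (cases "s = 0")
        case True
        with lt show ?thesis by simp
      next
        case False
        with s lt show ?thesis
          by (intro add_le_less_mono mult_left_mono mult_strict_left_mono) auto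
      qed
    qed
    show "(\<lambda>k. (1 - s) * x k + s * y k) ` {0..<N} \<subseteq> I"
    proof
      fix t assume "t \<in> (\<lambda>k. (1 - s) * x k + s * y k) ` {0..<N}"
      then obtain k where k: "k \<in> {0..<N}" "t = (1 - s) * x k + s * y k"
        by blast
      then have "x k \<in> I" "y k \<in> I"
        using x(2) y(2) by blast+
      with convexD[OF I, of "x k" "y k" "1 - s" s] s k(2) show "t \<in> I"
        by simp
    qed
  qed
  have g01: "g 0 = F x" "g 1 = F y"
    by (simp_all add: g_def)
  assume "\<not> F x * F y > 0"
  then consider "g 0 \<le> 0" "0 \<le> g 1" | "g 1 \<le> 0" "0 \<le> g 0"
    unfolding g01 by (cases "F x \<le> 0"; cases "F y \<le> 0") (force simp: zero_less_mult_iff)+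
  then obtain s where "0 \<le> s" "s \<le> 1" "g s = 0"
  proof cases
    case 1
    then show thesis
      using IVT'[of g 0 0 1] cont that by (auto simp: g_def)
  next
    case 2
    then show thesis
      using IVT2'[of g 1 0 0] cont that by (auto simp: g_def)
  qed
  with g_nz show False
    by blast
qed

section \<open>Coinciding points and the product measure\<close>

lemma ex_balls_separating:
  fixes F :: "'a::metric_space set"
  assumes "finite F"
  obtains d :: "'a \<Rightarrow> real" where "\<And>a. a \<in> F \<Longrightarrow> d a > 0"
    "\<And>a b. a \<in> F \<Longrightarrow> b \<in> F \<Longrightarrow> a \<noteq> b \<Longrightarrow> ball a (d a) \<inter> ball b (d b) = {}"
proof -
  have "\<forall>a. \<exists>d>0. \<forall>x\<in>F. x \<noteq> a \<longrightarrow> d \<le> dist a x"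
    using finite_set_avoid[OF assms] by blast
  then obtain d where d: "\<And>a. d a > 0" "\<And>a x. x \<in> F \<Longrightarrow> x \<noteq> a \<Longrightarrow> d a \<le> dist a x"
    by metis
  show thesis
  proof (rule that[of "\<lambda>a. d a / 2"])
    fix a b assume ab: "a \<in> F" "b \<in> F" "a \<noteq> b"
    have "d a \<le> dist a b" "d b \<le> dist a b"
      using d(2)[of b a] d(2)[of a b] ab by (auto simp: dist_commute)
    moreover have "dist a b \<le> dist a z + dist b z" for z
      using dist_triangle[of a b z] by (simp add: dist_commute)
    ultimately have "\<not> (dist a z < d a / 2 \<and> dist b z < d b / 2)" for z
      by (smt (verit) field_sum_of_halves)
    then show "ball a (d a / 2) \<inter> ball b (d b / 2) = {}"
      by (auto simp: disjoint_iff)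
  qed (use d(1) in auto)
qed

text \<open>Take disjoint balls around N distinct points of the support. Each has positive measure,
  hence so has their product box, and every tuple in the box is injective.\<close>

lemma not_AE_PiM_not_inj:
  fixes \<mu> :: "'a::metric_space measure"
  assumes "prob_space \<mu>" and sets: "sets \<mu> = sets borel" and inf: "infinite (measure_support \<mu>)"
  shows "\<not> (AE x in PiM {0..<N::nat} (\<lambda>_. \<mu>). \<not> inj_on x {0..<N})"
proof
  interpret prob_space \<mu> by fact
  interpret product_sigma_finite "\<lambda>_::nat. \<mu>"
    by (simp add: product_sigma_finite_def sigma_finite_measure_axioms)
  assume AE: "AE x in PiM {0..<N} (\<lambda>_. \<mu>). \<not> inj_on x {0..<N}"
  obtain G where G: "finite G" "card G = N" "G \<subseteq> measure_support \<mu>"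
    using infinite_arbitrarily_large[OF inf, of N] by blast
  obtain z where z: "bij_betw z {0..<N} G"
    using ex_bij_betw_nat_finite[OF G(1)] G(2) by blast
  obtain d where d: "\<And>a. a \<in> G \<Longrightarrow> d a > 0"
    "\<And>a b. a \<in> G \<Longrightarrow> b \<in> G \<Longrightarrow> a \<noteq> b \<Longrightarrow> ball a (d a) \<inter> ball b (d b) = {}"
    using ex_balls_separating[OF G(1)] by metis
  define U where "U k = ball (z k) (d (z k))" for k
  have zG: "z k \<in> G" if "k < N" for k
    using z that by (auto simp: bij_betw_def)
  have U: "U k \<in> sets \<mu>" "0 < measure \<mu> (U k)" if "k < N" for k
  proof -
    show "U k \<in> sets \<mu>"
      by (simp add: U_def sets)
    have "emeasure \<mu> (U k) > 0"
      using G(3) zG[OF that] d(1)[OF zG[OF that]] by (auto simp: U_def measure_support_def)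
    then show "0 < measure \<mu> (U k)"
      by (simp add: emeasure_eq_measure)
  qed
  let ?B = "Pi\<^sub>E {0..<N} U"
  have "emeasure (PiM {0..<N} (\<lambda>_. \<mu>)) ?B = (\<Prod>k\<in>{0..<N}. emeasure \<mu> (U k))"
    using U(1) by (intro emeasure_PiM) auto
  also have "\<dots> = ennreal (\<Prod>k\<in>{0..<N}. measure \<mu> (U k))"
    by (simp add: emeasure_eq_measure prod_ennreal)
  finally have "emeasure (PiM {0..<N} (\<lambda>_. \<mu>)) ?B \<noteq> 0"
    using U(2) by (simp add: ennreal_eq_0_iff not_le) (rule prod_pos, simp)
  moreover have "?B \<in> sets (PiM {0..<N} (\<lambda>_. \<mu>))"
    using U(1) by (intro sets_PiM_I_finite) auto
  moreover have "AE x in PiM {0..<N} (\<lambda>_. \<mu>). x \<notin> ?B"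
    using AE
  proof eventually_elim
    case (elim x)
    have "inj_on x {0..<N}" if "x \<in> ?B"
    proof (rule inj_onI)
      fix i j assume ij: "i \<in> {0..<N}" "j \<in> {0..<N}" "x i = x j"
      have "x i \<in> U i \<inter> U j"
        using that ij by (metis IntI PiE_mem)
      moreover have "z i \<in> G" "z j \<in> G"
        using zG ij(1,2) by auto
      ultimately have "z i = z j"
        using d(2) unfolding U_def by blast
      then show "i = j"
        using z ij(1,2) by (auto simp: bij_betw_def dest: inj_onD)
    qed
    with elim show ?case
      by blast
  qed
  ultimately show False
    by (auto simp: AE_iff_null_sets[symmetric] null_sets_def)
qed

text \<open>Swapping two equal points leaves the tuple unchanged but reverses the sign of the
  determinant.\<close>

lemma det_collocation_mat_not_inj:
  fixes u :: "nat \<Rightarrow> 'a \<Rightarrow> real"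
  assumes "\<not> inj_on x {0..<N}"
  shows "det (collocation_mat N u x) = 0"
proof -
  obtain i j where ij: "i < N" "j < N" "i \<noteq> j" "x i = x j"
    using assms by (auto simp: inj_on_def)
  let ?p = "Transposition.transpose i j"
  have "?p permutes {0..<N}"
    using ij by (intro permutes_swap_id) auto
  moreover have "(\<lambda>k. x (?p k)) = x"
    using ij(4) by (auto simp: Transposition.transpose_def)
  ultimately show ?thesis
    using det_collocation_mat_permute[of ?p N u x] ij(3) by (simp add: sign_swap_id)
qed

section \<open>Nonvanishing of the moment determinant\<close>

text \<open>If the determinant were 0, Andreief's identity would make the integral of
  \<open>F\<close>, the product of the two collocation determinants, vanish. As \<open>F\<close> has
  one sign, it would vanish almost everywhere, and almost every tuple would have a repeated point,
  against \<open>not_AE_PiM_not_inj\<close>. The set \<open>S\<close> is there because the angle is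
  injective on the arc but not on the plane.\<close>

lemma trig_moment_det_nonzero:
  fixes \<mu> :: "'a::metric_space measure" and \<theta> :: "'a \<Rightarrow> real" and u :: "nat \<Rightarrow> real \<Rightarrow> real"
  assumes \<mu>: "prob_space \<mu>" "sets \<mu> = sets borel" "infinite (measure_support \<mu>)"
    and S: "AE z in \<mu>. z \<in> S" "inj_on \<theta> S" "\<theta> ` S \<subseteq> I"
    and I: "convex I" "I \<subseteq> {a..<a + 2 * pi}"
    and cont: "\<And>j. j < N \<Longrightarrow> continuous_on I (u j)"
    and nz: "\<And>x. inj_on x {0..<N} \<Longrightarrow> x ` {0..<N} \<subseteq> I \<Longrightarrow> det (collocation_mat N u x) \<noteq> 0"
    and int: "\<And>l m. l < N \<Longrightarrow> m < N \<Longrightarrow>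
      integrable \<mu> (\<lambda>z. half_exp N l (\<theta> z) * complex_of_real (u m (\<theta> z)))"
  shows "det (Matrix.mat N N
    (\<lambda>(l, m). \<integral>z. half_exp N l (\<theta> z) * complex_of_real (u m (\<theta> z)) \<partial>\<mu>)) \<noteq> 0"
proof
  assume det0: "det (Matrix.mat N N
    (\<lambda>(l, m). \<integral>z. half_exp N l (\<theta> z) * complex_of_real (u m (\<theta> z)) \<partial>\<mu>)) = 0"
  interpret prob_space \<mu> by fact
  let ?P = "PiM {0..<N} (\<lambda>_. \<mu>)"
  obtain c where c: "c \<noteq> 0" "\<And>x. c * det (collocation_mat N (half_exp N) x) \<in> \<real>"
    using det_half_exp_real_multiple by blast
  define E where "E x = Re (c * det (collocation_mat N (half_exp N) x))" for x
  define F where "F x = E x * det (collocation_mat N u x)" for x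
  have E_eq: "complex_of_real (E x) = c * det (collocation_mat N (half_exp N) x)" for x
    unfolding E_def by (rule of_real_Re[OF c(2)])
  \<comment> \<open>Both determinants pick up \<open>sign p\<close>, whose square is 1.\<close>
  have F_permute: "F (\<lambda>k. x (p k)) = F x" if "p permutes {0..<N}" for x p
  proof -
    have "complex_of_real (E (\<lambda>k. x (p k))) = of_real (of_int (sign p) * E x)"
      unfolding of_real_mult E_eq det_collocation_mat_permute[OF that] by simp
    then have "E (\<lambda>k. x (p k)) = of_int (sign p) * E x"
      by (simp only: of_real_eq_iff)
    then show ?thesis
      by (simp add: F_def det_collocation_mat_permute[OF that] sign_def)
  qed
  have F_nz: "F x \<noteq> 0" if "inj_on x {0..<N}" "x ` {0..<N} \<subseteq> I" for x
  proof -
    have "complex_of_real (E x) \<noteq> 0"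
      using det_half_exp_nonzero[OF that(1), of a] that(2) I(2) c(1) unfolding E_eq by auto
    then show ?thesis
      using nz[OF that] by (simp add: F_def)
  qed
  have F_cont: "continuous_on {0..1} (\<lambda>s. F (\<lambda>k. (1 - s) * x k + s * y k))"
    if "x ` {0..<N} \<subseteq> I" "y ` {0..<N} \<subseteq> I" for x y
  proof -
    have "continuous_on {0..1} (\<lambda>s. u j ((1 - s) * x k + s * y k))" if jk: "j < N" "k < N" for j k
    proof (rule continuous_on_compose2[OF cont[OF jk(1)]])
      have "x k \<in> I" "y k \<in> I"
        using \<open>x ` {0..<N} \<subseteq> I\<close> \<open>y ` {0..<N} \<subseteq> I\<close> jk(2) by auto
      then show "(\<lambda>s. (1 - s) * x k + s * y k) ` {0..1} \<subseteq> I"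
        using convexD[OF I(1), of "x k" "y k"] by auto
    qed (intro continuous_intros)
    moreover have "p k < N" if "p permutes {0..<N}" "k < N" for p k
      using permutes_in_image[OF that(1), of k] that(2) by simp
    ultimately show ?thesis
      unfolding F_def E_def det_collocation_mat half_exp_def cis_conv_exp
      by (intro continuous_intros) auto
  qed
  \<comment> \<open>Sorting both tuples does not change \<open>F\<close>, so it suffices to compare
    signs on increasing tuples.\<close>
  have F_sign: "F x * F y > 0"
    if x: "inj_on x {0..<N}" "x ` {0..<N} \<subseteq> I" and y: "inj_on y {0..<N}" "y ` {0..<N} \<subseteq> I" for x y
  proof -
    obtain p where p: "p permutes {0..<N}" "strict_mono_on {0..<N} (\<lambda>k. x (p k))"
      using ex_permutes_strict_mono[OF x(1)] .
    obtain q where q: "q permutes {0..<N}" "strict_mono_on {0..<N} (\<lambda>k. y (q k))"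
      using ex_permutes_strict_mono[OF y(1)] .
    have px: "(\<lambda>k. x (p k)) ` {0..<N} \<subseteq> I" "(\<lambda>k. y (q k)) ` {0..<N} \<subseteq> I"
      using x(2) y(2) permutes_image[OF p(1)] permutes_image[OF q(1)] by (auto simp flip: image_image)
    have "F (\<lambda>k. x (p k)) * F (\<lambda>k. y (q k)) > 0"
      using F_cont[OF px] F_nz
      by (intro sign_constant_on_increasing_tuples[OF I(1) _ _ p(2) px(1) q(2) px(2)])
        (auto intro: strict_mono_on_imp_inj_on)
    then show ?thesis
      by (simp add: F_permute p q)
  qed
  let ?f = "\<lambda>l z. half_exp N l (\<theta> z)" and ?g = "\<lambda>m z. complex_of_real (u m (\<theta> z))"
  \<comment> \<open>Composed with the angle, \<open>F\<close> is \<open>c\<close> times the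
    integrand of Andreief's identity for the two systems regarded as functions on the space of
    \<open>\<mu>\<close>.\<close>
  have F_eq: "complex_of_real (F (\<lambda>k. \<theta> (x k))) =
      c * (det (collocation_mat N ?f x) * det (collocation_mat N ?g x))" for x
  proof -
    have "det (collocation_mat N ?g x) = complex_of_real (det (collocation_mat N u (\<lambda>k. \<theta> (x k))))"
      by (simp add: det_collocation_mat)
    moreover have "collocation_mat N ?f x = collocation_mat N (half_exp N) (\<lambda>k. \<theta> (x k))"
      by (simp add: collocation_mat_def)
    ultimately show ?thesis
      by (simp add: F_def E_eq)
  qed
  have "integrable ?P (\<lambda>x. complex_of_real (F (\<lambda>k. \<theta> (x k))))"
    unfolding F_eq
    using integrable_det_mult_det[OF sigma_finite_measure_axioms int] by (rule integrable_mult_right)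
  then have F_int: "integrable ?P (\<lambda>x. F (\<lambda>k. \<theta> (x k)))"
    using integrable_Re by fastforce
  have "complex_of_real (\<integral>x. F (\<lambda>k. \<theta> (x k)) \<partial>?P) =
      (\<integral>x. complex_of_real (F (\<lambda>k. \<theta> (x k))) \<partial>?P)"
    by simp
  also have "\<dots> = 0"
    unfolding F_eq integral_mult_right_zero
    using integral_det_mult_det[OF sigma_finite_measure_axioms int] det0 by simp
  finally have F_integral: "(\<integral>x. F (\<lambda>k. \<theta> (x k)) \<partial>?P) = 0"
    by simp
  have AE_S: "AE x in ?P. \<forall>k\<in>{0..<N}. x k \<in> S"
    by (intro AE_finite_allI AE_PiM_component[where M = "\<lambda>_. \<mu>"] S(1) prob_space_axioms) auto
  have tuple: "inj_on (\<lambda>k. \<theta> (x k)) {0..<N}" "(\<lambda>k. \<theta> (x k)) ` {0..<N} \<subseteq> I"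
    if "\<forall>k\<in>{0..<N}. x k \<in> S" "inj_on x {0..<N}" for x
  proof -
    show "inj_on (\<lambda>k. \<theta> (x k)) {0..<N}"
      using that S(2) by (auto simp: inj_on_def)
    show "(\<lambda>k. \<theta> (x k)) ` {0..<N} \<subseteq> I"
      using that(1) S(3) by auto
  qed
  note not_AE = not_AE_PiM_not_inj[OF \<mu>, of N]
  \<comment> \<open>A reference tuple: its value \<open>?F0\<close> stands for the unknown sign of
    \<open>F\<close> and makes \<open>?F0 * F\<close> nonnegative. Without such a tuple almost every
    tuple would be non-injective.\<close>
  obtain x0 where x0: "\<forall>k\<in>{0..<N}. x0 k \<in> S" "inj_on x0 {0..<N}"
  proof (rule ccontr)
    assume "\<not> thesis"
    with that have "\<not> inj_on x {0..<N}" if "\<forall>k\<in>{0..<N}. x k \<in> S" for x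
      using \<open>\<forall>k\<in>{0..<N}. x k \<in> S\<close> by blast
    then have "AE x in ?P. \<not> inj_on x {0..<N}"
      using AE_S by (auto elim: eventually_mono)
    with not_AE show False ..
  qed
  let ?F0 = "F (\<lambda>k. \<theta> (x0 k))"
  have "AE x in ?P. 0 \<le> ?F0 * F (\<lambda>k. \<theta> (x k))"
    using AE_S
  proof eventually_elim
    case (elim x)
    show ?case
    proof (cases "inj_on x {0..<N}")
      case True
      then show ?thesis
        using F_sign[OF tuple[OF x0] tuple[OF elim]] by simp
    next
      case False
      then have "\<not> inj_on (\<lambda>k. \<theta> (x k)) {0..<N}"
        unfolding inj_on_def by metis
      then show ?thesis
        by (simp add: F_def det_collocation_mat_not_inj)
    qed
  qed
  moreover have "(\<integral>x. ?F0 * F (\<lambda>k. \<theta> (x k)) \<partial>?P) = 0"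
    by (simp add: F_integral)
  ultimately have "AE x in ?P. ?F0 * F (\<lambda>k. \<theta> (x k)) = 0"
    using F_int by (subst (asm) integral_nonneg_eq_0_iff_AE) (auto intro: integrable_mult_right)
  \<comment> \<open>On an injective tuple from \<open>S\<close> the product with \<open>?F0\<close>
    is strictly positive, so its vanishing forces two equal points.\<close>
  with AE_S have "AE x in ?P. \<not> inj_on x {0..<N}"
  proof eventually_elim
    case (elim x)
    then show ?case
      using F_sign[OF tuple[OF x0] tuple[OF elim(1)]] by auto
  qed
  with not_AE show False ..
qed

section \<open>Square linear systems\<close>

text \<open>The unknowns are attached to the rows of \<open>A\<close>, so the matrix of the system
  is the transpose.\<close>

lemma
  fixes A :: "'a::field mat"
  assumes A: "A \<in> carrier_mat N N" and det: "det A \<noteq> 0"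
  shows linear_system_solvable: "\<exists>\<kappa>. \<forall>m<N. (\<Sum>l<N. \<kappa> l * A $$ (l, m)) = b m"
    and linear_system_unique: "\<lbrakk>\<forall>m<N. (\<Sum>l<N. \<kappa> l * A $$ (l, m)) = 0; l < N\<rbrakk> \<Longrightarrow> \<kappa> l = 0"
proof -
  let ?T = "transpose_mat A"
  have T: "?T \<in> carrier_mat N N"
    using A by simp
  have detT: "det ?T \<noteq> 0"
    using det det_transpose[OF A] by simp
  have mult: "(?T *\<^sub>v v) $ m = (\<Sum>l<N. v $ l * A $$ (l, m))" if "v \<in> carrier_vec N" "m < N" for v m
    using A that by (auto simp: scalar_prod_def atLeast0LessThan mult.commute intro!: sum.cong)
  obtain B where B: "B \<in> carrier_mat N N" "?T * B = 1\<^sub>m N"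
    using det_non_zero_imp_unit[OF T detT, of "()"] unfolding Units_def ring_mat_def by auto
  define v where "v = B *\<^sub>v Matrix.vec N b"
  have v: "v \<in> carrier_vec N"
    using B(1) by (simp add: v_def)
  have "?T *\<^sub>v v = Matrix.vec N b"
    unfolding v_def using B T by (subst assoc_mult_mat_vec[symmetric, of _ N N _ N]) auto
  then have "(\<Sum>l<N. v $ l * A $$ (l, m)) = b m" if "m < N" for m
    using mult[OF v that] that by simp
  then show "\<exists>\<kappa>. \<forall>m<N. (\<Sum>l<N. \<kappa> l * A $$ (l, m)) = b m"
    by blast
  assume \<kappa>: "\<forall>m<N. (\<Sum>l<N. \<kappa> l * A $$ (l, m)) = 0" and l: "l < N"
  have "?T *\<^sub>v Matrix.vec N \<kappa> = 0\<^sub>v N"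
    using A \<kappa> by (intro eq_vecI) (auto simp: mult simp del: index_mult_mat_vec)
  then have "Matrix.vec N \<kappa> = 0\<^sub>v N"
    using detT det_0_iff_vec_prod_zero_field[OF T] vec_carrier by blast
  then show "\<kappa> l = 0"
    using l by (metis index_vec index_zero_vec(1))
qed

section \<open>The branch of the argument on the arc\<close>

text \<open>Away from 0 the branch is a rotated and shifted \<open>Arg2pi\<close>, whose sublevel
  sets are closed. At 0 every real number is an argument, so the value there is an unspecified
  constant and is split off.\<close>

lemma borel_measurable_arg_from [measurable]: "arg_from t0 \<in> borel_measurable borel"
proof -
  have [measurable]: "Arg2pi \<in> borel_measurable borel"
    by (rule borel_measurableI_le) (auto intro: borel_closed closed_Arg2pi2pi_le)
  have "arg_from t0 = (\<lambda>z. if z = 0 then arg_from t0 0 else t0 + Arg2pi (z * cis (- t0)))"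
    by (auto simp: arg_from_eq_Arg2pi)
  also have "\<dots> \<in> borel_measurable borel"
    by measurable
  finally show ?thesis .
qed

lemma borel_measurable_half_pow [measurable]: "half_pow t0 m \<in> borel_measurable borel"
proof -
  have [measurable]: "sqrt_branch t0 \<in> borel_measurable borel"
    unfolding sqrt_branch_def[abs_def] by measurable
  show ?thesis
    unfolding half_pow_def[abs_def] power_int_def by measurable
qed

lemma half_pow_norm_1:
  assumes "norm z = 1"
  shows "half_pow t0 m z = cis (of_int m / 2 * arg_from t0 z)"
proof -
  have "sqrt_branch t0 z = cis (arg_from t0 z / 2)"
    using assms by (simp add: sqrt_branch_def cis_conv_exp)
  then show ?thesis
    by (simp add: half_pow_def cis_power_int)
qed

text \<open>Only for \<beta> = \<alpha> + 2 pi does the half-open period cut something off: the arc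
  then ends where it begins, and this point receives the angle \<alpha>. That \<open>cis\<close>
  inverts the angle makes the angle injective on the arc.\<close>

lemma circle_arc_arg_from:
  assumes "z \<in> circle_arc \<alpha> \<beta>" "\<beta> - \<alpha> \<le> 2 * pi"
  shows "arg_from \<alpha> z \<in> {\<alpha>..\<beta>} \<inter> {\<alpha>..<\<alpha> + 2 * pi}" "cis (arg_from \<alpha> z) = z" "norm z = 1"
proof -
  obtain t where t: "\<alpha> \<le> t" "t \<le> \<beta>" "z = cis t"
    using assms(1) by (auto simp: circle_arc_def)
  show "norm z = 1"
    by (simp add: t)
  have arg: "arg_from \<alpha> z = s" if "\<alpha> \<le> s" "s < \<alpha> + 2 * pi" "z = cis s" for s
    using that by (intro arg_from_eqI) (auto simp: is_Arg_def cis_conv_exp)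
  have "arg_from \<alpha> z \<in> {\<alpha>..\<beta>} \<inter> {\<alpha>..<\<alpha> + 2 * pi} \<and> cis (arg_from \<alpha> z) = z"
  proof (cases "t < \<alpha> + 2 * pi")
    case True
    with t arg[of t] show ?thesis by auto
  next
    case False
    with t assms(2) have "t = \<alpha> + 2 * pi"
      by linarith
    then have "z = cis \<alpha>"
      by (simp add: t cis.code)
    with t arg[of \<alpha>] show ?thesis by auto
  qed
  then show "arg_from \<alpha> z \<in> {\<alpha>..\<beta>} \<inter> {\<alpha>..<\<alpha> + 2 * pi}" "cis (arg_from \<alpha> z) = z"
    by auto
qed

section \<open>Trigonometric families and exponentials\<close>

lemma length_Trig: "length (Trig m f) = m"
  by (auto simp: Trig_def length_concat comp_def sum_list_triv elim!: oddE)

lemma set_Trig_even: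
  "set (Trig (2 * h) f) = (\<Union>k\<in>{1..h}. {\<lambda>\<theta>. f \<theta> * cos ((2 * real k - 1) / 2 * \<theta>),
     \<lambda>\<theta>. f \<theta> * sin ((2 * real k - 1) / 2 * \<theta>)})"
  by (simp add: Trig_def atLeastLessThanSuc_atLeastAtMost del: upt_Suc)

lemma set_Trig_odd:
  "set (Trig (Suc (2 * h)) f) =
     insert f (\<Union>k\<in>{1..h}. {\<lambda>\<theta>. f \<theta> * cos (real k * \<theta>), \<lambda>\<theta>. f \<theta> * sin (real k * \<theta>)})"
  by (simp add: Trig_def atLeastLessThanSuc_atLeastAtMost del: upt_Suc)

text \<open>Splits off the density, so that measurability of \<open>u\<close> composed with the
  angle follows from that of the density composed with the angle.\<close>

lemma Trig_memE:
  assumes "u \<in> set (Trig m f)"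
  obtains g where "u = (\<lambda>t. f t * g t)" "continuous_on UNIV g"
proof (cases "even m")
  case True
  then obtain k where "u = (\<lambda>\<theta>. f \<theta> * cos ((2 * real k - 1) / 2 * \<theta>)) \<or>
      u = (\<lambda>\<theta>. f \<theta> * sin ((2 * real k - 1) / 2 * \<theta>))"
    using assms set_Trig_even[of "m div 2" f] by auto
  then show thesis
    by (elim disjE) (rule that, assumption, intro continuous_intros)+
next
  case False
  then consider "u = f" | k where "u = (\<lambda>\<theta>. f \<theta> * cos (real k * \<theta>)) \<or> u = (\<lambda>\<theta>. f \<theta> * sin (real k * \<theta>))"
    using assms set_Trig_odd[of "m div 2" f] by auto
  then show thesis
  proof cases
    case 1
    then show thesis
      by (intro that[of "\<lambda>_. 1"]) auto
  next
    case 2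
    then show thesis
      by (elim disjE) (rule that, assumption, intro continuous_intros)+
  qed
qed

text \<open>Euler's formulas express each pair through the other;
  \<open>has_bochner_integral\<close> carries integrability along in both directions.\<close>

lemma has_bochner_integral_cis_pair_iff:
  fixes g :: "'a \<Rightarrow> complex"
  shows "has_bochner_integral M (\<lambda>z. g z * cis (s * \<theta> z)) 0 \<and>
      has_bochner_integral M (\<lambda>z. g z * cis (- s * \<theta> z)) 0 \<longleftrightarrow>
    has_bochner_integral M (\<lambda>z. g z * of_real (cos (s * \<theta> z))) 0 \<and>
      has_bochner_integral M (\<lambda>z. g z * of_real (sin (s * \<theta> z))) 0"
    (is "?p \<and> ?m \<longleftrightarrow> ?c \<and> ?s")
proof (intro iffI conjI; elim conjE)
  have cis: "cis (s * \<theta> z) = of_real (cos (s * \<theta> z)) + \<i> * of_real (sin (s * \<theta> z))"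
    "cis (- s * \<theta> z) = of_real (cos (s * \<theta> z)) - \<i> * of_real (sin (s * \<theta> z))" for z
    by (simp_all add: complex_eq_iff)
  {
    assume p: ?p and m: ?m
    have "has_bochner_integral M (\<lambda>z. 1/2 * (g z * cis (s * \<theta> z) + g z * cis (- s * \<theta> z))) (1/2 * (0 + 0))"
      by (intro has_bochner_integral_mult_right has_bochner_integral_add p m)
    then show ?c
      unfolding cis by (simp add: algebra_simps)
    have "has_bochner_integral M (\<lambda>z. (- \<i>/2) * (g z * cis (s * \<theta> z) - g z * cis (- s * \<theta> z)))
        ((- \<i>/2) * (0 - 0))"
      by (intro has_bochner_integral_mult_right has_bochner_integral_diff p m)
    then show ?s
      unfolding cis by (simp add: algebra_simps)
  next
    assume c: ?c and s: ?s
    have "has_bochner_integral M (\<lambda>z. g z * of_real (cos (s * \<theta> z)) + \<i> * (g z * of_real (sin (s * \<theta> z))))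
        (0 + \<i> * 0)"
      by (intro has_bochner_integral_mult_right has_bochner_integral_add c s)
    then show ?p
      unfolding cis by (simp add: algebra_simps)
    have "has_bochner_integral M (\<lambda>z. g z * of_real (cos (s * \<theta> z)) - \<i> * (g z * of_real (sin (s * \<theta> z))))
        (0 - \<i> * 0)"
      by (intro has_bochner_integral_mult_right has_bochner_integral_diff c s)
    then show ?m
      unfolding cis by (simp add: algebra_simps)
  }
qed

text \<open>The exponents (n-1)/2 - i come in pairs s, -s, matching the cosine and sine of frequency
  s; for odd n the exponent 0 matches \<open>w\<close> itself. Hence both families have the same
  complex span.\<close>

lemma orthogonal_Trig_iff:
  fixes g :: "'a \<Rightarrow> complex" and w :: "real \<Rightarrow> real"
  shows "(\<forall>u\<in>set (Trig n w). has_bochner_integral M (\<lambda>z. g z * of_real (u (\<theta> z))) 0) \<longleftrightarrow>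
    (\<forall>i<n. has_bochner_integral M (\<lambda>z. g z * of_real (w (\<theta> z)) * half_exp n i (\<theta> z)) 0)"
    (is "?L \<longleftrightarrow> ?R")
proof -
  define h where "h = n div 2"
  define Q where "Q s \<longleftrightarrow> has_bochner_integral M (\<lambda>z. (g z * of_real (w (\<theta> z))) * cis (s * \<theta> z)) 0"
    for s :: real
  have Q: "has_bochner_integral M (\<lambda>z. g z * of_real (w (\<theta> z) * cos (s * \<theta> z))) 0 \<and>
      has_bochner_integral M (\<lambda>z. g z * of_real (w (\<theta> z) * sin (s * \<theta> z))) 0 \<longleftrightarrow> Q s \<and> Q (- s)" for s
    unfolding Q_def using has_bochner_integral_cis_pair_iff[of M "\<lambda>z. g z * of_real (w (\<theta> z))" s \<theta>]
    by (simp add: mult.assoc)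
  have R: "?R \<longleftrightarrow> (\<forall>i<n. Q ((real n - 1) / 2 - real i))"
    by (simp add: Q_def half_exp_def)
  show ?thesis
  proof (cases "even n")
    case True
    then have n: "n = 2 * h"
      by (simp add: h_def)
    have "?L \<longleftrightarrow> (\<forall>k\<in>{1..h}. Q ((2 * real k - 1) / 2) \<and> Q (- ((2 * real k - 1) / 2)))"
      unfolding n set_Trig_even Q[symmetric] by (simp add: ball_conj_distrib)
    also have "\<dots> \<longleftrightarrow> (\<forall>i<n. Q ((real n - 1) / 2 - real i))"
    proof (intro iffI ballI allI impI conjI)
      fix i assume *: "\<forall>k\<in>{1..h}. Q ((2 * real k - 1) / 2) \<and> Q (- ((2 * real k - 1) / 2))" and i: "i < n"
      \<comment> \<open>For i < h the exponent is positive and belongs to k = h - i; from i = h on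
        it is negative and belongs to k = i + 1 - h.\<close>
      show "Q ((real n - 1) / 2 - real i)"
      proof (cases "i < h")
        case True
        then have "h - i \<in> {1..h}"
          by auto
        then have "Q ((2 * real (h - i) - 1) / 2)"
          using * by blast
        moreover have "(2 * real (h - i) - 1) / 2 = (real n - 1) / 2 - real i"
          using True n by (simp add: of_nat_diff field_simps)
        ultimately show ?thesis by simp
      next
        case False
        then have "i + 1 - h \<in> {1..h}"
          using i n by auto
        then have "Q (- ((2 * real (i + 1 - h) - 1) / 2))"
          using * by blast
        moreover have "- ((2 * real (i + 1 - h) - 1) / 2) = (real n - 1) / 2 - real i"
          using False n by (simp add: of_nat_diff field_simps)
        ultimately show ?thesis by simp
      qed
    next
      fix k assume *: "\<forall>i<n. Q ((real n - 1) / 2 - real i)" and k: "k \<in> {1..h}"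
      have "Q ((real n - 1) / 2 - real (h - k))"
        using k n by (intro *[rule_format]) auto
      moreover have "(real n - 1) / 2 - real (h - k) = (2 * real k - 1) / 2"
        using k n by (simp add: of_nat_diff field_simps)
      ultimately show "Q ((2 * real k - 1) / 2)" by simp
      have "Q ((real n - 1) / 2 - real (h + k - 1))"
        using k n by (intro *[rule_format]) auto
      moreover have "(real n - 1) / 2 - real (h + k - 1) = - ((2 * real k - 1) / 2)"
        using k n by (simp add: of_nat_diff field_simps)
      ultimately show "Q (- ((2 * real k - 1) / 2))" by simp
    qed
    finally show ?thesis
      unfolding R .
  next
    case False
    then have n: "n = Suc (2 * h)"
      by (simp add: h_def)
    have "?L \<longleftrightarrow> Q 0 \<and> (\<forall>k\<in>{1..h}. Q (real k) \<and> Q (- real k))"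
      unfolding n set_Trig_odd Q[symmetric] by (simp add: ball_conj_distrib) (simp add: Q_def)
    also have "\<dots> \<longleftrightarrow> (\<forall>i<n. Q ((real n - 1) / 2 - real i))"
    proof (intro iffI ballI allI impI conjI; (elim conjE)?)
      fix i assume *: "\<forall>k\<in>{1..h}. Q (real k) \<and> Q (- real k)" "Q 0" and i: "i < n"
      \<comment> \<open>Here the exponent is h - i: the middle index gives frequency 0, the others k
        = |h - i| with either sign.\<close>
      consider "i < h" | "i = h" | "i > h"
        by linarith
      then show "Q ((real n - 1) / 2 - real i)"
      proof cases
        case 1
        then have "h - i \<in> {1..h}"
          by auto
        then have "Q (real (h - i))"
          using * by blast
        with 1 n show ?thesis by (simp add: of_nat_diff)
      next
        case 2
        with * n show ?thesis by simp
      next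
        case 3
        then have "i - h \<in> {1..h}"
          using i n by auto
        then have "Q (- real (i - h))"
          using *(1) by blast
        with 3 n show ?thesis by (simp add: of_nat_diff)
      qed
    next
      assume *: "\<forall>i<n. Q ((real n - 1) / 2 - real i)"
      have "Q ((real n - 1) / 2 - real h)"
        using n by (intro *[rule_format]) auto
      with n show "Q 0" by simp
      fix k assume k: "k \<in> {1..h}"
      have "Q ((real n - 1) / 2 - real (h - k))"
        using k n by (intro *[rule_format]) auto
      with k n show "Q (real k)" by (simp add: of_nat_diff)
      have "Q ((real n - 1) / 2 - real (h + k))"
        using k n by (intro *[rule_format]) auto
      with k n show "Q (- real k)" by simp
    qed
    finally show ?thesis
      unfolding R .
  qed
qed

section \<open>Normality as a linear system\<close>

lemma has_bochner_integral_density_iff: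
  fixes f :: "'a \<Rightarrow> 'b::{banach, second_countable_topology}" and g :: "'a \<Rightarrow> real"
  assumes "f \<in> borel_measurable M" "g \<in> borel_measurable M" "AE x in M. 0 \<le> g x"
  shows "has_bochner_integral (density M g) f v \<longleftrightarrow> has_bochner_integral M (\<lambda>x. g x *\<^sub>R f x) v"
  using assms by (simp add: has_bochner_integral_iff integrable_density integral_density)

theorem theorem5p2:
  fixes \<alpha> \<beta> :: real and r :: nat and n :: "nat \<Rightarrow> nat" and M :: "nat \<Rightarrow> complex measure"
  assumes "AT_system \<alpha> \<beta> r n M"
  shows "phi_normal \<alpha> r n M"
proof -
  define N where "N = mi_size r n"
  define \<theta> where "\<theta> = arg_from \<alpha>"
  obtain \<mu> w where \<alpha>\<beta>: "\<beta> - \<alpha> \<le> 2 * pi"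
    and \<mu>: "sets \<mu> = sets borel" "prob_space \<mu>" "AE z in \<mu>. z \<in> circle_arc \<alpha> \<beta>"
      "infinite (measure_support \<mu>)"
    and w: "\<And>j. j \<in> {1..r} \<Longrightarrow> (\<lambda>z. w j (\<theta> z)) \<in> borel_measurable \<mu>"
      "\<And>j. j \<in> {1..r} \<Longrightarrow> AE z in \<mu>. 0 \<le> w j (\<theta> z)"
      "\<And>j. j \<in> {1..r} \<Longrightarrow> M j = density \<mu> (\<lambda>z. ennreal (w j (\<theta> z)))"
    and cheb: "chebyshev_on \<alpha> \<beta> (concat (map (\<lambda>j. Trig (n j) (w j)) [1..<Suc r]))"
    using assms unfolding AT_system_def \<theta>_def by blast
  interpret prob_space \<mu> by fact
  define us where "us = concat (map (\<lambda>j. Trig (n j) (w j)) [1..<Suc r])"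
  have len: "length us = N"
    by (simp add: us_def N_def mi_size_def length_concat comp_def length_Trig interv_sum_list_conv_sum_set_nat
        atLeastLessThanSuc_atLeastAtMost del: upt_Suc)
  have set_us: "set us = (\<Union>j\<in>{1..r}. set (Trig (n j) (w j)))"
    by (simp add: us_def atLeastLessThanSuc_atLeastAtMost del: upt_Suc)
  have borel_\<mu>: "f \<in> borel_measurable \<mu>" if "f \<in> borel_measurable borel" for f :: "complex \<Rightarrow> 'a::topological_space"
    using that measurable_cong_sets[OF \<mu>(1) refl] by blast
  have \<theta>_meas [measurable]: "\<theta> \<in> borel_measurable \<mu>"
    unfolding \<theta>_def by (rule borel_\<mu>) measurable
  have us_cont: "continuous_on {\<alpha>..\<beta>} u" if "u \<in> set us" for u
    using cheb that unfolding chebyshev_on_def us_def by blast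
  have us_meas: "(\<lambda>z. u (\<theta> z)) \<in> borel_measurable \<mu>" if u: "u \<in> set us" for u
  proof -
    obtain j where j: "j \<in> {1..r}" "u \<in> set (Trig (n j) (w j))"
      using u unfolding set_us by blast
    note [measurable] = w(1)[OF j(1)]
    obtain f where f: "u = (\<lambda>t. w j t * f t)" "continuous_on UNIV f"
      using Trig_memE[OF j(2)] .
    note [measurable] = borel_measurable_continuous_onI[OF f(2)]
    show ?thesis
      unfolding f(1) by measurable
  qed
  have arc: "\<theta> z \<in> {\<alpha>..\<beta>} \<inter> {\<alpha>..<\<alpha> + 2 * pi}" "cis (\<theta> z) = z" "norm z = 1"
    if "z \<in> circle_arc \<alpha> \<beta>" for z
    using circle_arc_arg_from[OF that \<alpha>\<beta>] by (auto simp: \<theta>_def)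
  \<comment> \<open>For almost every point the angle lies in the compact interval on which
    \<open>u\<close> is continuous, so the integrand is essentially bounded.\<close>
  have us_int: "integrable \<mu> (\<lambda>z. cis (s * \<theta> z) * complex_of_real (u (\<theta> z)))" if u: "u \<in> set us" for s u
  proof -
    note [measurable] = us_meas[OF u]
    have "bounded (u ` {\<alpha>..\<beta>})"
      using us_cont[OF u] by (intro compact_imp_bounded compact_continuous_image) auto
    then obtain B where B: "\<And>t. t \<in> {\<alpha>..\<beta>} \<Longrightarrow> \<bar>u t\<bar> \<le> B"
      unfolding bounded_iff by (metis imageI real_norm_def)
    show ?thesis
    proof (rule integrable_const_bound)
      show "AE z in \<mu>. norm (cis (s * \<theta> z) * complex_of_real (u (\<theta> z))) \<le> B"
        using \<mu>(3) by eventually_elim (use arc(1) B in \<open>auto simp: norm_mult\<close>)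
    qed (unfold cis_conv_exp, measurable)
  qed
  \<comment> \<open>\<open>A\<close> holds the moments of the terms with free coefficients and
    \<open>b\<close> those of the leading term, whose exponent N/2 becomes (N+1)/2 after
    multiplication by z^(1/2).\<close>
  define A where "A = Matrix.mat N N
    (\<lambda>(l, m). \<integral>z. half_exp N l (\<theta> z) * complex_of_real ((us ! m) (\<theta> z)) \<partial>\<mu>)"
  define b where "b m = (\<integral>z. cis ((real N + 1) / 2 * \<theta> z) * complex_of_real ((us ! m) (\<theta> z)) \<partial>\<mu>)" for m
  have half_int: "integrable \<mu> (\<lambda>z. half_exp N l (\<theta> z) * complex_of_real ((us ! m) (\<theta> z)))"
    if "m < N" for l m
    unfolding half_exp_def using that len by (intro us_int) auto
  have A: "A \<in> carrier_mat N N"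
    by (simp add: A_def)
  \<comment> \<open>The interval is cut down to a half-open period, within which the exponentials
    separate angles.\<close>
  have "det A \<noteq> 0"
    unfolding A_def
  proof (rule trig_moment_det_nonzero[OF \<mu>(2,1,4,3), where I = "{\<alpha>..\<beta>} \<inter> {\<alpha>..<\<alpha> + 2 * pi}" and a = \<alpha>])
    show "inj_on \<theta> (circle_arc \<alpha> \<beta>)"
      using arc(2) by (intro inj_on_inverseI[of _ cis])
    show "\<theta> ` circle_arc \<alpha> \<beta> \<subseteq> {\<alpha>..\<beta>} \<inter> {\<alpha>..<\<alpha> + 2 * pi}"
      using arc(1) by blast
    show "continuous_on ({\<alpha>..\<beta>} \<inter> {\<alpha>..<\<alpha> + 2 * pi}) (us ! j)" if "j < N" for j
      using us_cont[of "us ! j"] that len by (auto intro: continuous_on_subset)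
    show "det (collocation_mat N ((!) us) x) \<noteq> 0"
      if "inj_on x {0..<N}" "x ` {0..<N} \<subseteq> {\<alpha>..\<beta>} \<inter> {\<alpha>..<\<alpha> + 2 * pi}" for x
      using cheb that len unfolding chebyshev_on_def us_def[symmetric] collocation_mat_def
      by (auto simp: atLeast0LessThan)
  qed (use half_int in \<open>auto intro: convex_Int\<close>)
  note system = linear_system_solvable[OF A this] linear_system_unique[OF A this]
  define \<Phi> where "\<Phi> \<kappa> = (\<lambda>z. half_pow \<alpha> (int N) z +
    (\<Sum>l = 1..N. \<kappa> l * half_pow \<alpha> (int N - 2 * int l) z))" for \<kappa> :: "nat \<Rightarrow> complex"
  have \<Phi>_meas: "\<Phi> \<kappa> \<in> borel_measurable borel" for \<kappa>
    unfolding \<Phi>_def by measurable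
  \<comment> \<open>Multiplication by z^(1/2) raises every exponent by 1/2. The coefficients of
    \<open>\<Phi>\<close> are numbered from 1 and the exponentials from 0, hence
    \<open>Suc l\<close>.\<close>
  have \<Phi>_eq: "\<Phi> \<kappa> z * cis (\<theta> z / 2) =
      cis ((real N + 1) / 2 * \<theta> z) + (\<Sum>l<N. \<kappa> (Suc l) * half_exp N l (\<theta> z))"
    if "z \<in> circle_arc \<alpha> \<beta>" for \<kappa> z
  proof -
    have "half_pow \<alpha> m z * cis (\<theta> z / 2) = cis ((real_of_int m + 1) / 2 * \<theta> z)" for m
      using half_pow_norm_1[OF arc(3)[OF that]] by (simp add: \<theta>_def cis_mult field_simps)
    then show ?thesis
      by (simp add: \<Phi>_def ring_distribs sum_distrib_right half_exp_def mult.assoc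
          sum.atLeast1_atMost_eq) 
        (intro sum.cong refl arg_cong2[where f = "(*)"] arg_cong[of _ _ cis]; simp add: field_simps)
  qed
  \<comment> \<open>The density moves from the measure into the integrand, and the test power
    z^(n_j/2 - i) splits into z^(1/2), which joins \<open>\<Phi>\<close>, and an exponential that
    \<open>orthogonal_Trig_iff\<close> trades for the family \<open>Trig\<close>.\<close>
  have orth_j: "(\<forall>i<n j. has_bochner_integral (M j) (\<lambda>z. \<Phi> \<kappa> z * half_pow \<alpha> (int (n j) - 2 * int i) z) 0) \<longleftrightarrow>
      (\<forall>u\<in>set (Trig (n j) (w j)).
        has_bochner_integral \<mu> (\<lambda>z. \<Phi> \<kappa> z * cis (\<theta> z / 2) * of_real (u (\<theta> z))) 0)"
    if j: "j \<in> {1..r}" for \<kappa> j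
  proof -
    note [measurable] = w(1)[OF j] borel_\<mu>[OF \<Phi>_meas] borel_\<mu>[OF borel_measurable_half_pow]
    have "has_bochner_integral (M j) (\<lambda>z. \<Phi> \<kappa> z * half_pow \<alpha> (int (n j) - 2 * int i) z) 0 \<longleftrightarrow>
        has_bochner_integral \<mu>
          (\<lambda>z. \<Phi> \<kappa> z * cis (\<theta> z / 2) * of_real (w j (\<theta> z)) * half_exp (n j) i (\<theta> z)) 0" for i
    proof -
      have "has_bochner_integral (M j) (\<lambda>z. \<Phi> \<kappa> z * half_pow \<alpha> (int (n j) - 2 * int i) z) 0 \<longleftrightarrow>
          has_bochner_integral \<mu>
            (\<lambda>z. w j (\<theta> z) *\<^sub>R (\<Phi> \<kappa> z * half_pow \<alpha> (int (n j) - 2 * int i) z)) 0"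
        unfolding w(3)[OF j] by (intro has_bochner_integral_density_iff w j) measurable
      also have "\<dots> \<longleftrightarrow> has_bochner_integral \<mu>
          (\<lambda>z. \<Phi> \<kappa> z * cis (\<theta> z / 2) * of_real (w j (\<theta> z)) * half_exp (n j) i (\<theta> z)) 0"
      proof (rule has_bochner_integral_cong_AE)
        show "AE z in \<mu>. w j (\<theta> z) *\<^sub>R (\<Phi> \<kappa> z * half_pow \<alpha> (int (n j) - 2 * int i) z) =
            \<Phi> \<kappa> z * cis (\<theta> z / 2) * of_real (w j (\<theta> z)) * half_exp (n j) i (\<theta> z)"
          using \<mu>(3)
        proof eventually_elim
          case (elim z)
          have "half_pow \<alpha> (int (n j) - 2 * int i) z = cis (\<theta> z / 2) * half_exp (n j) i (\<theta> z)"
            using half_pow_norm_1[OF arc(3)[OF elim]]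
            by (simp add: \<theta>_def half_exp_def cis_mult field_simps)
          then show ?case
            by (simp add: scaleR_conv_of_real)
        qed
      qed (unfold half_exp_def cis_conv_exp, measurable)
      finally show ?thesis .
    qed
    then show ?thesis
      by (simp only: orthogonal_Trig_iff)
  qed
  have orth: "phi_orthogonal \<alpha> r n M (\<Phi> \<kappa>) \<longleftrightarrow> (\<forall>m<N. (\<Sum>l<N. \<kappa> (Suc l) * A $$ (l, m)) = - b m)" for \<kappa>
  proof -
    have "phi_orthogonal \<alpha> r n M (\<Phi> \<kappa>) \<longleftrightarrow>
        (\<forall>u\<in>set us. has_bochner_integral \<mu> (\<lambda>z. \<Phi> \<kappa> z * cis (\<theta> z / 2) * of_real (u (\<theta> z))) 0)"
      unfolding phi_orthogonal_def set_us using orth_j by auto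
    also have "\<dots> \<longleftrightarrow>
        (\<forall>m<N. has_bochner_integral \<mu> (\<lambda>z. \<Phi> \<kappa> z * cis (\<theta> z / 2) * of_real ((us ! m) (\<theta> z))) 0)"
      by (simp add: all_set_conv_all_nth len)
    also have "\<dots> \<longleftrightarrow> (\<forall>m<N. (\<Sum>l<N. \<kappa> (Suc l) * A $$ (l, m)) = - b m)"
    proof (intro all_cong)
      fix m assume m: "m < N"
      have us: "us ! m \<in> set us"
        using m len by auto
      note [measurable] = us_meas[OF us] borel_\<mu>[OF \<Phi>_meas]
      let ?R = "\<lambda>z. cis ((real N + 1) / 2 * \<theta> z) * of_real ((us ! m) (\<theta> z)) +
          (\<Sum>l<N. \<kappa> (Suc l) * (half_exp N l (\<theta> z) * of_real ((us ! m) (\<theta> z))))"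
      have "has_bochner_integral \<mu> (\<lambda>z. \<Phi> \<kappa> z * cis (\<theta> z / 2) * of_real ((us ! m) (\<theta> z))) 0 \<longleftrightarrow>
          has_bochner_integral \<mu> ?R 0"
      proof (rule has_bochner_integral_cong_AE)
        show "AE z in \<mu>. \<Phi> \<kappa> z * cis (\<theta> z / 2) * of_real ((us ! m) (\<theta> z)) = ?R z"
          using \<mu>(3)
          by eventually_elim (simp add: \<Phi>_eq distrib_right sum_distrib_right mult.assoc)
      qed (unfold half_exp_def cis_conv_exp, measurable)
      \<comment> \<open>The integral has exactly one value, so it is 0 if and only if the m-th
        equation holds.\<close>
      moreover have "has_bochner_integral \<mu> ?R (b m + (\<Sum>l<N. \<kappa> (Suc l) * A $$ (l, m)))"
      proof (intro has_bochner_integral_add has_bochner_integral_sum has_bochner_integral_mult_right)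
        show "has_bochner_integral \<mu>
            (\<lambda>z. cis ((real N + 1) / 2 * \<theta> z) * of_real ((us ! m) (\<theta> z))) (b m)"
          unfolding b_def by (rule has_bochner_integral_integrable[OF us_int[OF us]])
        fix l assume "l \<in> {..<N}"
        then show "has_bochner_integral \<mu>
            (\<lambda>z. half_exp N l (\<theta> z) * of_real ((us ! m) (\<theta> z))) (A $$ (l, m))"
          using has_bochner_integral_integrable[OF half_int[OF m]] m by (simp add: A_def)
      qed
      ultimately show "has_bochner_integral \<mu> (\<lambda>z. \<Phi> \<kappa> z * cis (\<theta> z / 2) * of_real ((us ! m) (\<theta> z))) 0 \<longleftrightarrow>
          (\<Sum>l<N. \<kappa> (Suc l) * A $$ (l, m)) = - b m"
        by (simp only: has_bochner_integral_iff add_eq_0_iff simp_thms)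
    qed
    finally show ?thesis .
  qed
  have form: "phi_form \<alpha> N \<phi> \<longleftrightarrow> (\<exists>\<kappa>. \<phi> = \<Phi> \<kappa>)" for \<phi>
    by (simp add: phi_form_def \<Phi>_def)
  obtain \<kappa> where \<kappa>: "\<forall>m<N. (\<Sum>l<N. \<kappa> l * A $$ (l, m)) = - b m"
    using system(1)[of "\<lambda>m. - b m"] by blast
  show ?thesis
    unfolding phi_normal_def N_def[symmetric] form
  proof (rule ex_ex1I)
    \<comment> \<open>Taking \<open>\<kappa> (l - 1)\<close> as coefficients undoes the shift
      between numbering from 1 and from 0.\<close>
    show "\<exists>\<phi>. (\<exists>\<kappa>. \<phi> = \<Phi> \<kappa>) \<and> phi_orthogonal \<alpha> r n M \<phi>"
      using orth[of "\<lambda>l. \<kappa> (l - 1)"] \<kappa> by auto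
  next
    fix \<phi> \<psi> assume "(\<exists>\<kappa>. \<phi> = \<Phi> \<kappa>) \<and> phi_orthogonal \<alpha> r n M \<phi>"
      "(\<exists>\<kappa>. \<psi> = \<Phi> \<kappa>) \<and> phi_orthogonal \<alpha> r n M \<psi>"
    then obtain \<kappa>1 \<kappa>2 where *: "\<phi> = \<Phi> \<kappa>1" "\<psi> = \<Phi> \<kappa>2"
      "\<forall>m<N. (\<Sum>l<N. \<kappa>1 (Suc l) * A $$ (l, m)) = - b m" "\<forall>m<N. (\<Sum>l<N. \<kappa>2 (Suc l) * A $$ (l, m)) = - b m"
      using orth by blast
    \<comment> \<open>The difference of two solutions solves the homogeneous system.\<close>
    then have "\<forall>m<N. (\<Sum>l<N. (\<kappa>1 (Suc l) - \<kappa>2 (Suc l)) * A $$ (l, m)) = 0"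
      by (simp add: left_diff_distrib sum_subtractf)
    then have "\<kappa>1 (Suc l) = \<kappa>2 (Suc l)" if "l < N" for l
      using system(2)[of "\<lambda>l. \<kappa>1 (Suc l) - \<kappa>2 (Suc l)" l] that by simp
    \<comment> \<open>Agreement on 1, ..., N gives equal functions, since \<open>\<Phi>\<close>
      reads no other coefficients.\<close>
    then have "\<kappa>1 l = \<kappa>2 l" if "l \<in> {1..N}" for l
      using that by (cases l) auto
    then show "\<phi> = \<psi>"
      unfolding *(1,2) \<Phi>_def by (auto intro!: sum.cong)
  qed
qed

end
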